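(* Let $(M,g)$ be the Robinson–Trautman spacetime with coordinates $(t,r,x,y)$, constants $a,b,d\in\mathbb R$ and function $f=f(x,y)$, and let $F_1=f_x^2+f_y^2-f(f_{xx}+f_{yy})$. If $F_1-2a+4br\neq0$ and $rF_1-2ar+6d\neq0$, then the spacetime admits generalized concircular inheritance for the vector field $\xi=\frac{\partial}{\partial x}$, given by $$\mathscr L_\xi W=\lambda_W W+\lambda_1\,g\wedge g+\lambda_2\,g\wedge S,$$ where $$\lambda_W=-\frac{F_4}{f(-6d+2ar-rF_1)},$$ $$\begin{aligned}\lambda_1=&\ \frac{\Big[\frac{4b}{3r^2f}(-6d+2ar-rF_1)-\frac{1}{6r^3f}(-2a+12br+F_1)\{-12d+r(-2a+12br+F_1)\}\Big]F_4}{2(2a-4br-F_1)(-6d+2ar-rF_1)}\\&-\frac{(F_1-2a+12br)\{2f_yf_{xy}+f_x(f_{xx}-f_{yy})-f(f_{xyy}+f_{xxx})\}}{12r^2(2a-4br-F_1)}\\&-\frac{2b\big[2rf_x^3+f_x\{12d-4ar+2rf_y^2-rf(3f_{xx}+f_{yy})\}+rf\{-2f_yf_{xy}+f(f_{xyy}+f_{xxx})\}\big]}{3r^2f(2a-4br-F_1)},\end{aligned}$$ $$\lambda_2=\frac{f_x(-6d+2ar-rF_1)}{3rf(-2a+4br+F_1)}+\frac{(-3d+2br^2)F_4}{rf(F_1-2a+4br)(-6d+2ar-rF_1)},$$ $$F_4=(-12d+8ar-8br^2)f_x-4rf_y^2f_x+3rff_{yy}f_x-4rf_x^3+2rff_y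f_{xy}-rf^2f_{xyy}+5rff_xf_{xx}-rf^2f_{xxx}.$$
   Context: Robinson–Trautman (RT) spacetime: $a,b,d\in\mathbb R$ are constants; $M=I\times J\times\Omega$ with coordinates $(x^1,x^2,x^3,x^4)=(t,r,x,y)$, where $I\subset\mathbb R$ and $J\subset\mathbb R\setminus\{0\}$ are open intervals and $\Omega\subset\mathbb R^2$ is open, connected and nonempty; $f:\Omega\to\mathbb R$ is smooth and nowhere vanishing, with subscripts denoting partial derivatives; the metric is $$g=-2\Big(a-2br-\frac dr\Big)dt^2+2\,dt\,dr-\frac{r^2}{f^2}(dx^2+dy^2).$$ ($2\,dt\,dr$ means $g_{12}=g_{21}=1$.) Curvature conventions: with $\Gamma$ the Levi-Civita connection coefficients, $R_{pqrs}=g_{p\alpha}(\partial_r\Gamma^\alpha_{qs}-\partial_s\Gamma^\alpha_{qr}+\Gamma^\beta_{qs}\Gamma^\alpha_{\beta r}-\Gamma^\beta_{qr}\Gamma^\alpha_{\beta s})$, the Ricci tensor is $S_{qr}=g^{ps}R_{pqrs}$ and the scalar curvature is $\kappa=g^{qr}S_{qr}$. With this convention $R_{1212}=-\frac{2d}{r^3}$, $S_{12}=-\frac{4b}{r}$, $S_{33}=S_{44}=\frac{F_1-2a+8br}{f^2}$, $\kappa=-\frac{2}{r^2}(F_1-2a+12br)$. The Kulkarni–Nomizu product of symmetric $(0,2)$ tensors is $(\phi\wedge\psi)_{pqrs}=\phi_{ps}\psi_{qr}-\phi_{pr}\psi_{qs}+\phi_{qr}\psi_{ps}-\phi_{qs}\psi_{pr}$.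 The concircular $(0,4)$ curvature tensor (dimension 4) is $W=R-\frac{\kappa}{12}G$ with $G=\frac12\,g\wedge g$. Generalized concircular inheritance with respect to $\xi$ means $\mathscr L_\xi W=\lambda W+\lambda_1 g\wedge g+\lambda_2 g\wedge S$ for smooth functions $\lambda,\lambda_1,\lambda_2$, where $\mathscr L_\xi$ is the Lie derivative of the $(0,4)$ tensor.
   Formalization: The factor -6d+2ar-rF_1 has its sign reversed to 6d-2ar+rF_1 in two numerators, the first term in the bracket of λ_1 and the first term of λ_2; as printed the equation fails, e.g. for a=b=d=0, f=x, where λ_2 must be 1/(3x), not -1/(3x). *)

theory Defs
  imports "HOL-Analysis.Analysis"
begin

text \<open>
  \<open>Ck_on k S f\<close>: \<open>f\<close> is \<open>k\<close> times continuously differentiable on \<open>S\<close>. It is meant for open \<open>S\<close>,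
  since derivatives are taken in the ambient space.
\<close>

primrec Ck_on :: "nat \<Rightarrow> 'a::real_normed_vector set \<Rightarrow> ('a \<Rightarrow> 'b::real_normed_vector) \<Rightarrow> bool" where
  "Ck_on 0 S f \<longleftrightarrow> continuous_on S f"
| "Ck_on (Suc k) S f \<longleftrightarrow>
     (\<forall>x\<in>S. f differentiable (at x)) \<and> (\<forall>v. Ck_on k S (\<lambda>x. frechet_derivative f (at x) v))"

definition smooth_on :: "'a::real_normed_vector set \<Rightarrow> ('a \<Rightarrow> 'b::real_normed_vector) \<Rightarrow> bool" where
  "smooth_on S f \<longleftrightarrow> (\<forall>k. Ck_on k S f)"

definition partial :: "'n::finite \<Rightarrow> (real^'n \<Rightarrow> real) \<Rightarrow> real^'n \<Rightarrow> real" where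
  "partial i F p = deriv (\<lambda>s. F (p + s *\<^sub>R axis i 1)) 0"


text \<open>
  Everything lives on an open subset of \<open>real^'n\<close> carrying its standard coordinates. A (0,2) tensor
  field is a matrix-valued function; a (0,4) tensor field is the family of its components,
  each a function of the point.
\<close>

type_synonym 'n tensor02 = "real^'n \<Rightarrow> real^'n^'n"
type_synonym 'n tensor04 = "'n \<Rightarrow> 'n \<Rightarrow> 'n \<Rightarrow> 'n \<Rightarrow> real^'n \<Rightarrow> real"

text \<open>\<open>christoffel g i j k\<close> is \<open>\<Gamma>\<close> with upper index \<open>i\<close> and lower indices \<open>j\<close>, \<open>k\<close>.\<close>

definition christoffel :: "('n::finite) tensor02 \<Rightarrow> 'n \<Rightarrow> 'n \<Rightarrow> 'n \<Rightarrow> real^'n \<Rightarrow> real" where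
  "christoffel g i j k p = 1/2 * (\<Sum>l\<in>UNIV. matrix_inv (g p) $ i $ l *
     (partial j (\<lambda>z. g z $ l $ k) p + partial k (\<lambda>z. g z $ l $ j) p - partial l (\<lambda>z. g z $ j $ k) p))"

definition riemann :: "('n::finite) tensor02 \<Rightarrow> 'n tensor04" where
  "riemann g p q r s z = (\<Sum>i\<in>UNIV. g z $ p $ i *
     (partial r (christoffel g i q s) z - partial s (christoffel g i q r) z
      + (\<Sum>j\<in>UNIV. christoffel g j q s z * christoffel g i j r z
                  - christoffel g j q r z * christoffel g i j s z)))"

text \<open>
  The contraction is over the first and the last index of \<open>riemann\<close>, so \<open>ricci\<close> and \<open>scalar_curv\<close>
  have the opposite sign to the contraction over the first and the third.
\<close>

definition ricci :: "('n::finite) tensor02 \<Rightarrow> 'n tensor02" where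
  "ricci g z = (\<chi> q r. \<Sum>p\<in>UNIV. \<Sum>s\<in>UNIV. matrix_inv (g z) $ p $ s * riemann g p q r s z)"

definition scalar_curv :: "('n::finite) tensor02 \<Rightarrow> real^'n \<Rightarrow> real" where
  "scalar_curv g z = (\<Sum>q\<in>UNIV. \<Sum>r\<in>UNIV. matrix_inv (g z) $ q $ r * ricci g z $ q $ r)"

definition kulkarni_nomizu :: "('n::finite) tensor02 \<Rightarrow> 'n tensor02 \<Rightarrow> 'n tensor04" where
  "kulkarni_nomizu \<phi> \<psi> p q r s z =
     \<phi> z $ p $ s * \<psi> z $ q $ r - \<phi> z $ p $ r * \<psi> z $ q $ s
     + \<phi> z $ q $ r * \<psi> z $ p $ s - \<phi> z $ q $ s * \<psi> z $ p $ r"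

text \<open>The factor 12 is \<open>n * (n - 1)\<close> for \<open>n = 4\<close>.\<close>

definition concircular :: "4 tensor02 \<Rightarrow> 4 tensor04" where
  "concircular g p q r s z =
     riemann g p q r s z - scalar_curv g z / 12 * (1/2 * kulkarni_nomizu g g p q r s z)"

definition lie_derivative :: "(real^'n \<Rightarrow> real^'n) \<Rightarrow> ('n::finite) tensor04 \<Rightarrow> 'n tensor04" where
  "lie_derivative \<xi> T p q r s z = (\<Sum>k\<in>UNIV.
       \<xi> z $ k * partial k (T p q r s) z
     + T k q r s z * partial p (\<lambda>w. \<xi> w $ k) z
     + T p k r s z * partial q (\<lambda>w. \<xi> w $ k) z
     + T p q k s z * partial r (\<lambda>w. \<xi> w $ k) z
     + T p q r k z * partial s (\<lambda>w. \<xi> w $ k) z)"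

definition generalized_concircular_inheritance ::
  "(real^4) set \<Rightarrow> 4 tensor02 \<Rightarrow> (real^4 \<Rightarrow> real^4)
   \<Rightarrow> (real^4 \<Rightarrow> real) \<Rightarrow> (real^4 \<Rightarrow> real) \<Rightarrow> (real^4 \<Rightarrow> real) \<Rightarrow> bool" where
  "generalized_concircular_inheritance M g \<xi> l l1 l2 \<longleftrightarrow>
     smooth_on M l \<and> smooth_on M l1 \<and> smooth_on M l2 \<and>
     (\<forall>z\<in>M. \<forall>p q r s. lie_derivative \<xi> (concircular g) p q r s z =
        l z * concircular g p q r s z
        + l1 z * kulkarni_nomizu g g p q r s z
        + l2 z * kulkarni_nomizu g (ricci g) p q r s z)"


text \<open>
  Robinson-Trautman spacetime: the components 1, 2, 3, 4 of a point are \<open>t\<close>, \<open>r\<close>, \<open>x\<close>, \<open>y\<close>.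
\<close>

definition xy :: "real^4 \<Rightarrow> real^2" where
  "xy p = vector [p $ 3, p $ 4]"

definition rt_domain :: "real set \<Rightarrow> real set \<Rightarrow> (real^2) set \<Rightarrow> (real^4) set" where
  "rt_domain I J \<Omega> = {p. p $ 1 \<in> I \<and> p $ 2 \<in> J \<and> xy p \<in> \<Omega>}"

definition rt_metric :: "real \<Rightarrow> real \<Rightarrow> real \<Rightarrow> (real^2 \<Rightarrow> real) \<Rightarrow> 4 tensor02" where
  "rt_metric a b d f p =
    (let r = p $ 2; h = - (r\<^sup>2 / (f (xy p))\<^sup>2) in
     vector [vector [- 2 * (a - 2*b*r - d/r), 1, 0, 0],
             vector [1, 0, 0, 0],
             vector [0, 0, h, 0],
             vector [0, 0, 0, h]])"

definition rt_F1 :: "(real^2 \<Rightarrow> real) \<Rightarrow> real^4 \<Rightarrow> real" where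
  "rt_F1 f p =
    (let u = xy p; fx = partial 1 f; fy = partial 2 f in
     (fx u)\<^sup>2 + (fy u)\<^sup>2 - f u * (partial 1 fx u + partial 2 fy u))"

definition rt_F4 :: "real \<Rightarrow> real \<Rightarrow> real \<Rightarrow> (real^2 \<Rightarrow> real) \<Rightarrow> real^4 \<Rightarrow> real" where
  "rt_F4 a b d f p =
    (let r = p $ 2; u = xy p; F = f u;
         fx = partial 1 f u; fy = partial 2 f u;
         fxx = partial 1 (partial 1 f) u;
         fxy = partial 2 (partial 1 f) u;
         fyy = partial 2 (partial 2 f) u;
         fxxx = partial 1 (partial 1 (partial 1 f)) u;
         fxyy = partial 2 (partial 2 (partial 1 f)) u in
     (- 12*d + 8*a*r - 8*b*r\<^sup>2) * fx - 4*r * fy\<^sup>2 * fx + 3*r * F * fyy * fx - 4*r * fx^3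
     + 2*r * F * fy * fxy - r * F\<^sup>2 * fxyy + 5*r * F * fx * fxx - r * F\<^sup>2 * fxxx)"

definition rt_lambdaW :: "real \<Rightarrow> real \<Rightarrow> real \<Rightarrow> (real^2 \<Rightarrow> real) \<Rightarrow> real^4 \<Rightarrow> real" where
  "rt_lambdaW a b d f p =
    (let r = p $ 2; F = f (xy p); F1 = rt_F1 f p; F4 = rt_F4 a b d f p in
     - (F4 / (F * (- 6*d + 2*a*r - r*F1))))"

text \<open>
  In \<open>rt_lambda1\<close> and \<open>rt_lambda2\<close> the factor \<open>6*d - 2*a*r + r*F1\<close> deliberately has the opposite sign
  to the published formulas, which print \<open>-6d + 2ar - rF_1\<close> in these two numerators (the first term
  in the square bracket of \<open>\<lambda>_1\<close> and the first term of \<open>\<lambda>_2\<close>); all other occurrences are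
  as published. As printed, the inheritance equation fails: for \<open>a = b = d = 0\<close> and \<open>f = x\<close>
  on \<open>x > 0\<close>, both nonvanishing conditions hold, \<open>F_1 = 1\<close>, \<open>F_4 = -4r\<close>, \<open>\<lambda>_W = -4/x\<close>,
  \<open>\<lambda>_1 = 1/(3xr^2)\<close>, and the (1,3,2,3) component of the equation reads
  \<open>-1/(3x^3) = -2/(3x^3) + 2/(3x^3) - \<lambda>_2/x^2\<close>, forcing \<open>\<lambda>_2 = 1/(3x)\<close>, whereas
  the printed value is \<open>-1/(3x)\<close>.
\<close>

definition rt_lambda1 :: "real \<Rightarrow> real \<Rightarrow> real \<Rightarrow> (real^2 \<Rightarrow> real) \<Rightarrow> real^4 \<Rightarrow> real" where
  "rt_lambda1 a b d f p =
    (let r = p $ 2; u = xy p; F = f u; F1 = rt_F1 f p; F4 = rt_F4 a b d f p;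
         fx = partial 1 f u; fy = partial 2 f u;
         fxx = partial 1 (partial 1 f) u;
         fxy = partial 2 (partial 1 f) u;
         fyy = partial 2 (partial 2 f) u;
         fxxx = partial 1 (partial 1 (partial 1 f)) u;
         fxyy = partial 2 (partial 2 (partial 1 f)) u in
     (4*b / (3 * r\<^sup>2 * F) * (6*d - 2*a*r + r*F1)
        - 1 / (6 * r^3 * F) * (- 2*a + 12*b*r + F1) * (- 12*d + r * (- 2*a + 12*b*r + F1))) * F4
       / (2 * (2*a - 4*b*r - F1) * (- 6*d + 2*a*r - r*F1))
     - (F1 - 2*a + 12*b*r) * (2*fy*fxy + fx*(fxx - fyy) - F*(fxyy + fxxx))
       / (12 * r\<^sup>2 * (2*a - 4*b*r - F1))
     - 2*b * (2*r*fx^3 + fx * (12*d - 4*a*r + 2*r*fy\<^sup>2 - r*F*(3*fxx + fyy))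
              + r*F * (- 2*fy*fxy + F*(fxyy + fxxx)))
       / (3 * r\<^sup>2 * F * (2*a - 4*b*r - F1)))"

definition rt_lambda2 :: "real \<Rightarrow> real \<Rightarrow> real \<Rightarrow> (real^2 \<Rightarrow> real) \<Rightarrow> real^4 \<Rightarrow> real" where
  "rt_lambda2 a b d f p =
    (let r = p $ 2; u = xy p; F = f u; F1 = rt_F1 f p; F4 = rt_F4 a b d f p;
         fx = partial 1 f u in
     fx * (6*d - 2*a*r + r*F1) / (3 * r * F * (- 2*a + 4*b*r + F1))
     + (- 3*d + 2*b*r\<^sup>2) * F4 / (r * F * (F1 - 2*a + 4*b*r) * (- 6*d + 2*a*r - r*F1)))"

end

theory Submission
  imports Defs
begin

text \<open>
  Split the metric as \<open>g = k + m\<close>, where \<open>k\<close> is the block in the coordinates \<open>t\<close>, \<open>r\<close> and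
  \<open>m = - (r\<^sup>2 / f\<^sup>2) (dx\<^sup>2 + dy\<^sup>2)\<close>. Since \<open>g\<close> is a warped product with two-dimensional base and
  two-dimensional fibre, and since the Hessian of the warping function \<open>r\<close> on the base is
  proportional to \<open>k\<close>, the curvature tensor is a combination of just the three tensors
  \<open>k \<and> k\<close>, \<open>k \<and> m\<close> and \<open>m \<and> m\<close> (Kulkarni-Nomizu products), with functions as coefficients;
  this is \<open>riemann_eq\<close>. Hence \<open>W\<close>, \<open>g \<and> g\<close> and \<open>g \<and> S\<close> lie in the same three-dimensional space.
  With \<open>D = F\<^sub>1 - 2a + 4br\<close> and \<open>E = r F\<^sub>1 - 2ar + 6d\<close> one finds that \<open>W\<close> is the sum of
  \<open>- E / (6r\<^sup>3) (k \<and> k - k \<and> m + m \<and> m)\<close>, the Weyl tensor, and of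
  \<open>D / (4r\<^sup>2) (k \<and> k - m \<and> m)\<close>, the part given by the trace-free Ricci tensor;
  this is \<open>concircular_eq\<close>.

  The Lie derivative along \<open>\<partial>/\<partial>x\<close> is the \<open>x\<close>-derivative of the components. As \<open>k\<close> does not depend
  on \<open>x\<close> and \<open>\<partial>\<^sub>x m = - (2 f\<^sub>x / f) m\<close>, the derivative of \<open>W\<close> stays in the three-dimensional
  space, and the inheritance equation becomes a linear system of three scalar equations for the three
  coefficients, solved in \<open>inheritance_algebra\<close>. Its determinant is the product \<open>D E\<close> up to a
  constant factor and powers of \<open>r\<close>, and this is where the two functions assumed to be nonzero come
  from. The functional sending \<open>(u, v, w)\<close>, the coefficients
  of \<open>k \<and> k\<close>, \<open>k \<and> m\<close>, \<open>m \<and> m\<close>, to \<open>u - v + w\<close> annihilates \<open>g \<and> g\<close> and \<open>g \<and> S\<close>, so it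
  isolates \<open>\<lambda>_W\<close>; the other two coefficients follow. The only derivatives of \<open>f\<close> of third order
  come from \<open>\<partial>\<^sub>x F\<^sub>1\<close>, and in terms of \<open>X = \<partial>\<^sub>x F\<^sub>1\<close> the function \<open>F\<^sub>4\<close> is simply
  \<open>r f X - 2 f\<^sub>x (E + r D)\<close>.
\<close>

section \<open>Calculus of smooth functions\<close>

lemmas frechet_derivative_eq = frechet_derivative_at[symmetric]

text \<open>
  The definition of \<^const>\<open>Ck_on\<close> mentions the derivatives at the points of \<open>S\<close> only, and for open
  \<open>S\<close> these do not see the values outside \<open>S\<close>.
\<close>

lemma Ck_on_cong:
  assumes "open S" and "\<And>x. x \<in> S \<Longrightarrow> f x = g x" and "Ck_on k S f"
  shows "Ck_on k S g"
  using assms(2,3)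
proof (induction k arbitrary: f g)
  case 0
  then show ?case
    by (simp cong: continuous_on_cong)
next
  case (Suc k)
  have deriv: "(g has_derivative frechet_derivative f (at x)) (at x)" if "x \<in> S" for x
    using has_derivative_transform_within_open[OF _ \<open>open S\<close> that] Suc.prems that
    by (meson Ck_on.simps(2) frechet_derivative_works)
  have "Ck_on k S (\<lambda>x. frechet_derivative g (at x) v)" for v
    using Suc.IH[of "\<lambda>x. frechet_derivative f (at x) v" "\<lambda>x. frechet_derivative g (at x) v"]
      Suc.prems(2) frechet_derivative_eq[OF deriv] by simp
  then show ?case
    using deriv by (auto simp: differentiable_def)
qed

lemma Ck_on_SucI:
  assumes "open S" and "\<And>x. x \<in> S \<Longrightarrow> (f has_derivative f' x) (at x)"
    and "\<And>v. Ck_on k S (\<lambda>x. f' x v)"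
  shows "Ck_on (Suc k) S f"
proof -
  have "Ck_on k S (\<lambda>x. frechet_derivative f (at x) v)" for v
    using Ck_on_cong[OF assms(1) _ assms(3)[of v]] frechet_derivative_eq[OF assms(2)] by simp
  then show ?thesis
    using assms(2) by (auto simp: differentiable_def)
qed

lemma Ck_on_Suc_imp: "Ck_on (Suc k) S f \<Longrightarrow> Ck_on k S f"
proof (induction k arbitrary: f)
  case 0
  then show ?case
    by (simp add: continuous_at_imp_continuous_on differentiable_imp_continuous_within)
next
  case (Suc k)
  then show ?case
    by (metis Ck_on.simps(2))
qed

lemma Ck_on_const: "Ck_on k S (\<lambda>x. c)"
proof (induction k arbitrary: c)
  case (Suc k)
  then show ?case by simp
qed simp

lemma Ck_on_add:
  assumes "open S" "Ck_on k S f" "Ck_on k S g"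
  shows "Ck_on k S (\<lambda>x. f x + g x)"
  using assms(2,3)
proof (induction k arbitrary: f g)
  case 0
  then show ?case by (simp add: continuous_on_add)
next
  case (Suc k)
  show ?case
  proof (rule Ck_on_SucI[OF \<open>open S\<close>])
    show "((\<lambda>x. f x + g x) has_derivative
        (\<lambda>v. frechet_derivative f (at x) v + frechet_derivative g (at x) v)) (at x)"
      if "x \<in> S" for x
      using Suc.prems that by (intro has_derivative_add) (auto simp: frechet_derivative_works)
  qed (use Suc in auto)
qed

text \<open>
  In the inductions for products and inverses, the formula for the derivative contains, besides the
  derivatives of the given functions, these functions themselves, so that the induction hypothesis
  needs them at the next lower order; this is what \<open>Ck_on_Suc_imp\<close> provides.
\<close>

lemma Ck_on_mult:
  fixes f g :: "'a::real_normed_vector \<Rightarrow> real"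
  assumes "open S" "Ck_on k S f" "Ck_on k S g"
  shows "Ck_on k S (\<lambda>x. f x * g x)"
  using assms(2,3)
proof (induction k arbitrary: f g)
  case 0
  then show ?case by (simp add: continuous_on_mult)
next
  case (Suc k)
  show ?case
  proof (rule Ck_on_SucI[OF \<open>open S\<close>])
    show "((\<lambda>x. f x * g x) has_derivative
        (\<lambda>v. f x * frechet_derivative g (at x) v + frechet_derivative f (at x) v * g x)) (at x)"
      if "x \<in> S" for x
      using Suc.prems that by (intro has_derivative_mult) (auto simp: frechet_derivative_works)
    show "Ck_on k S (\<lambda>x. f x * frechet_derivative g (at x) v + frechet_derivative f (at x) v * g x)"
      for v
      using Suc.prems Ck_on_Suc_imp
      by (intro Ck_on_add[OF \<open>open S\<close>] Suc.IH) (auto simp del: Ck_on.simps simp: Ck_on.simps(2))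
  qed
qed

lemma Ck_on_inverse:
  fixes f :: "'a::real_normed_vector \<Rightarrow> real"
  assumes "open S" "Ck_on k S f" "\<And>x. x \<in> S \<Longrightarrow> f x \<noteq> 0"
  shows "Ck_on k S (\<lambda>x. inverse (f x))"
  using assms(2)
proof (induction k)
  case 0
  then show ?case using assms(3) by (simp add: continuous_on_inverse)
next
  case (Suc k)
  show ?case
  proof (rule Ck_on_SucI[OF \<open>open S\<close>])
    show "((\<lambda>x. inverse (f x)) has_derivative
        (\<lambda>v. (- 1) * (inverse (f x) * frechet_derivative f (at x) v * inverse (f x)))) (at x)"
      if "x \<in> S" for x
    proof -
      have "(f has_derivative frechet_derivative f (at x)) (at x)"
        using Suc.prems that by (simp add: frechet_derivative_works)
      from Deriv.has_derivative_inverse[OF assms(3)[OF that] this] show ?thesis by simp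
    qed
    show "Ck_on k S (\<lambda>x. (- 1) * (inverse (f x) * frechet_derivative f (at x) v * inverse (f x)))"
      for v
      using Suc Ck_on_Suc_imp[OF Suc.prems] by (intro Ck_on_mult[OF \<open>open S\<close>] Ck_on_const) auto
  qed
qed

lemma Ck_on_compose_linear:
  assumes "open S" "bounded_linear L" "\<And>x. x \<in> S \<Longrightarrow> L x \<in> T" "Ck_on k T f"
  shows "Ck_on k S (\<lambda>x. f (L x))"
  using assms(4)
proof (induction k arbitrary: f)
  case 0
  then show ?case
    using continuous_on_compose2[of T f S L] assms(2,3) linear_continuous_on by fastforce
next
  case (Suc k)
  show ?case
  proof (rule Ck_on_SucI[OF \<open>open S\<close>])
    show "((\<lambda>x. f (L x)) has_derivative (\<lambda>v. frechet_derivative f (at (L x)) (L v))) (at x)"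
      if "x \<in> S" for x
      using Suc.prems assms(2,3) that
      by (intro has_derivative_compose[of L L x UNIV f] bounded_linear_imp_has_derivative)
         (auto simp: frechet_derivative_works)
  qed (use Suc in auto)
qed

lemma Ck_on_bounded_linear:
  assumes "bounded_linear L"
  shows "Ck_on k S L"
proof (cases k)
  case 0
  then show ?thesis using assms by (simp add: linear_continuous_on)
next
  case (Suc n)
  have "(L has_derivative L) (at x)" for x
    by (rule bounded_linear_imp_has_derivative[OF assms])
  then have "frechet_derivative L (at x) = L" "L differentiable (at x)" for x
    by (auto simp: frechet_derivative_eq differentiable_def)
  then show ?thesis
    using Suc by (simp add: Ck_on_const)
qed

lemma smooth_on_const: "smooth_on S (\<lambda>x. c)"
  by (simp add: smooth_on_def Ck_on_const)

lemma smooth_on_nth: "smooth_on S (\<lambda>x::real^'n. x $ i)"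
  by (simp add: smooth_on_def Ck_on_bounded_linear bounded_linear_vec_nth)

lemma smooth_on_add:
  "open S \<Longrightarrow> smooth_on S f \<Longrightarrow> smooth_on S g \<Longrightarrow> smooth_on S (\<lambda>x. f x + g x)"
  by (simp add: smooth_on_def Ck_on_add)

lemma smooth_on_mult:
  fixes f g :: "'a::real_normed_vector \<Rightarrow> real"
  shows "open S \<Longrightarrow> smooth_on S f \<Longrightarrow> smooth_on S g \<Longrightarrow> smooth_on S (\<lambda>x. f x * g x)"
  by (simp add: smooth_on_def Ck_on_mult)

lemma smooth_on_minus:
  fixes f :: "'a::real_normed_vector \<Rightarrow> real"
  shows "open S \<Longrightarrow> smooth_on S f \<Longrightarrow> smooth_on S (\<lambda>x. - f x)"
  using smooth_on_mult[of S "\<lambda>x. - 1" f] smooth_on_const by auto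

lemma smooth_on_diff:
  fixes f g :: "'a::real_normed_vector \<Rightarrow> real"
  shows "open S \<Longrightarrow> smooth_on S f \<Longrightarrow> smooth_on S g \<Longrightarrow> smooth_on S (\<lambda>x. f x - g x)"
  using smooth_on_add[of S f "\<lambda>x. - g x"] smooth_on_minus[of S g] by simp

lemma smooth_on_power:
  fixes f :: "'a::real_normed_vector \<Rightarrow> real"
  shows "open S \<Longrightarrow> smooth_on S f \<Longrightarrow> smooth_on S (\<lambda>x. f x ^ n)"
  by (induction n) (auto simp: smooth_on_const smooth_on_mult)

lemma smooth_on_divide:
  fixes f g :: "'a::real_normed_vector \<Rightarrow> real"
  shows "open S \<Longrightarrow> smooth_on S f \<Longrightarrow> smooth_on S g \<Longrightarrow> (\<And>x. x \<in> S \<Longrightarrow> g x \<noteq> 0)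
    \<Longrightarrow> smooth_on S (\<lambda>x. f x / g x)"
  unfolding divide_inverse by (intro smooth_on_mult) (auto simp: smooth_on_def Ck_on_inverse)

lemma smooth_on_compose_linear:
  "open S \<Longrightarrow> bounded_linear L \<Longrightarrow> (\<And>x. x \<in> S \<Longrightarrow> L x \<in> T) \<Longrightarrow> smooth_on T f
    \<Longrightarrow> smooth_on S (\<lambda>x. f (L x))"
  unfolding smooth_on_def using Ck_on_compose_linear by blast

lemma smooth_on_imp_has_derivative:
  "smooth_on S f \<Longrightarrow> x \<in> S \<Longrightarrow> (f has_derivative frechet_derivative f (at x)) (at x)"
  by (metis Ck_on.simps(2) frechet_derivative_works smooth_on_def)

section \<open>Partial derivatives\<close>

text \<open>
  A relational form of \<^const>\<open>partial\<close> which, unlike the total function, also records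
  differentiability, so that the rules of differentiation need no separate differentiability
  conditions.
\<close>

definition has_partial :: "(real^'n \<Rightarrow> real) \<Rightarrow> real \<Rightarrow> 'n::finite \<Rightarrow> real^'n \<Rightarrow> bool" where
  "has_partial F D i p \<longleftrightarrow> ((\<lambda>s. F (p + s *\<^sub>R axis i 1)) has_real_derivative D) (at 0)"

lemma partial_eqI: "has_partial F D i p \<Longrightarrow> partial i F p = D"
  unfolding has_partial_def partial_def by (rule DERIV_imp_deriv)

lemma has_partial_line:
  assumes "has_partial F D i (p + t *\<^sub>R axis i 1)"
  shows "((\<lambda>s. F (p + s *\<^sub>R axis i 1)) has_real_derivative D) (at t)"
  using assms DERIV_shift[of "\<lambda>s. F (p + s *\<^sub>R axis i 1)" D 0 t]
  by (simp add: has_partial_def algebra_simps)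

lemma has_partial_cong:
  assumes "has_partial F D i p" "open S" "p \<in> S" "\<And>q. q \<in> S \<Longrightarrow> F q = G q"
  shows "has_partial G D i p"
proof -
  let ?T = "(\<lambda>s. p + s *\<^sub>R axis i 1) -` S"
  have "open ?T"
    by (rule open_vimage[OF \<open>open S\<close>]) (intro continuous_intros)
  then show ?thesis
    using has_field_derivative_transform_within_open[of _ D 0 ?T] assms
    unfolding has_partial_def by fastforce
qed

lemma has_partial_eq_rhs: "has_partial F D i p \<Longrightarrow> D = E \<Longrightarrow> has_partial F E i p"
  by simp

lemma has_partial_const: "has_partial (\<lambda>p. c) 0 i p"
  by (simp add: has_partial_def)

lemma has_partial_nth: "has_partial (\<lambda>p. p $ j) (if i = j then 1 else 0) i p"
  by (auto simp: has_partial_def axis_def intro!: derivative_eq_intros)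

lemma has_partial_add:
  "has_partial F D i p \<Longrightarrow> has_partial G E i p \<Longrightarrow> has_partial (\<lambda>p. F p + G p) (D + E) i p"
  unfolding has_partial_def by (rule DERIV_add)

lemma has_partial_minus: "has_partial F D i p \<Longrightarrow> has_partial (\<lambda>p. - F p) (- D) i p"
  unfolding has_partial_def by (rule DERIV_minus)

lemma has_partial_diff:
  "has_partial F D i p \<Longrightarrow> has_partial G E i p \<Longrightarrow> has_partial (\<lambda>p. F p - G p) (D - E) i p"
  unfolding has_partial_def by (rule DERIV_diff)

lemma has_partial_mult:
  "has_partial F D i p \<Longrightarrow> has_partial G E i p
    \<Longrightarrow> has_partial (\<lambda>p. F p * G p) (D * G p + E * F p) i p"
  unfolding has_partial_def by (drule (1) DERIV_mult) simp

lemma has_partial_power: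
  "has_partial F D i p \<Longrightarrow> has_partial (\<lambda>p. F p ^ n) (real n * (F p ^ (n - Suc 0) * D)) i p"
  unfolding has_partial_def by (auto intro!: derivative_eq_intros)

lemma has_partial_divide:
  "has_partial F D i p \<Longrightarrow> has_partial G E i p \<Longrightarrow> G p \<noteq> 0
    \<Longrightarrow> has_partial (\<lambda>p. F p / G p) ((D * G p - F p * E) / (G p * G p)) i p"
  unfolding has_partial_def by (drule (1) DERIV_divide) simp_all

lemmas has_partial_intros =
  has_partial_const has_partial_nth has_partial_add has_partial_minus has_partial_diff
  has_partial_mult has_partial_power has_partial_divide

lemma has_derivative_imp_has_partial:
  assumes "(F has_derivative F') (at p)"
  shows "has_partial F (F' (axis i 1)) i p"
proof -
  have "((\<lambda>s. F (p + s *\<^sub>R axis i 1)) has_derivative (\<lambda>s. F' (s *\<^sub>R axis i 1))) (at 0)"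
    by (rule has_derivative_compose[where f = "\<lambda>s. p + s *\<^sub>R axis i 1"])
       (use assms in \<open>auto intro!: derivative_eq_intros\<close>)
  moreover have "F' (s *\<^sub>R axis i 1) = F' (axis i 1) * s" for s
    using linear_scale[OF has_derivative_linear[OF assms]] by simp
  ultimately show ?thesis
    by (simp add: has_partial_def has_field_derivative_def)
qed

lemma smooth_on_has_partial:
  "smooth_on S F \<Longrightarrow> p \<in> S \<Longrightarrow> has_partial F (partial i F p) i p"
  using has_derivative_imp_has_partial[OF smooth_on_imp_has_derivative] partial_eqI by metis

lemma smooth_on_partial:
  assumes "open S" "smooth_on S F"
  shows "smooth_on S (partial i F)"
  unfolding smooth_on_def
proof
  fix k
  have "frechet_derivative F (at p) (axis i 1) = partial i F p" if "p \<in> S" for p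
    using partial_eqI[OF has_derivative_imp_has_partial[OF smooth_on_imp_has_derivative]] assms that
    by metis
  moreover have "Ck_on k S (\<lambda>p. frechet_derivative F (at p) (axis i 1))"
    using assms(2) unfolding smooth_on_def by (metis Ck_on.simps(2))
  ultimately show "Ck_on k S (partial i F)"
    by (rule Ck_on_cong[OF \<open>open S\<close>])
qed

lemma smooth_on_continuous_at:
  "open S \<Longrightarrow> smooth_on S F \<Longrightarrow> p \<in> S \<Longrightarrow> isCont F p"
  by (metis Ck_on.simps(1) continuous_on_eq_continuous_at smooth_on_def)

section \<open>Symmetry of the second partial derivatives\<close>

text \<open>
  Two applications of the mean value theorem, first in direction \<open>i\<close> to the increment of \<open>F\<close> in
  direction \<open>j\<close>, then in direction \<open>j\<close>. The left hand side is symmetric in \<open>i\<close> and \<open>j\<close>,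
  which is what makes the second partial derivatives commute.
\<close>

lemma second_difference_mean_value:
  fixes F :: "real^'n \<Rightarrow> real"
  assumes "smooth_on S F" "open S" "ball z \<epsilon> \<subseteq> S" "0 < h" "2 * h < \<epsilon>"
  shows "\<exists>q \<in> cball z (2 * h). F (z + h *\<^sub>R axis i 1 + h *\<^sub>R axis j 1) - F (z + h *\<^sub>R axis i 1)
           - F (z + h *\<^sub>R axis j 1) + F z = h * h * partial j (partial i F) q"
proof -
  let ?P = "\<lambda>s t. z + s *\<^sub>R axis i 1 + t *\<^sub>R axis j (1::real)"
  have near: "?P s t \<in> cball z (2 * h)" if "\<bar>s\<bar> \<le> h" "\<bar>t\<bar> \<le> h" for s t
  proof -
    have "norm (s *\<^sub>R axis i 1 + t *\<^sub>R axis j (1::real)) \<le> 2 * h"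
      using norm_triangle_ineq[of "s *\<^sub>R axis i 1" "t *\<^sub>R axis j (1::real)"] that by simp
    then show ?thesis
      by (metis (no_types, lifting) add.assoc add_diff_cancel_left' dist_commute dist_norm mem_cball)
  qed
  then have S: "?P s t \<in> S" if "\<bar>s\<bar> \<le> h" "\<bar>t\<bar> \<le> h" for s t
    using assms(3,5) that by fastforce
  have line_i: "((\<lambda>s. F (?P s t)) has_real_derivative partial i F (?P s t)) (at s)"
    if "\<bar>s\<bar> \<le> h" "\<bar>t\<bar> \<le> h" for s t
    using has_partial_line[of F _ i "z + t *\<^sub>R axis j 1" s]
      smooth_on_has_partial[OF assms(1) S[OF that]] by (simp add: algebra_simps)
  have "\<exists>s. 0 < s \<and> s < h \<and> (F (?P h h) - F (?P h 0)) - (F (?P 0 h) - F (?P 0 0))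
      = (h - 0) * (partial i F (?P s h) - partial i F (?P s 0))"
    by (intro MVT2 DERIV_diff line_i) (use assms(4) in auto)
  then obtain s where s: "0 < s" "s < h"
    and eq_s: "(F (?P h h) - F (?P h 0)) - (F (?P 0 h) - F (?P 0 0))
      = h * (partial i F (?P s h) - partial i F (?P s 0))"
    by auto
  have "\<exists>t. 0 < t \<and> t < h \<and> partial i F (?P s h) - partial i F (?P s 0)
      = (h - 0) * partial j (partial i F) (?P s t)"
    using s assms(4) S
    by (intro MVT2 has_partial_line smooth_on_has_partial[OF smooth_on_partial[OF assms(2,1)]]) auto
  then obtain t where t: "0 < t" "t < h"
    and eq_t: "partial i F (?P s h) - partial i F (?P s 0) = h * partial j (partial i F) (?P s t)"
    by auto
  show ?thesis
  proof
    show "?P s t \<in> cball z (2 * h)" using near s t by simp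
    show "F (z + h *\<^sub>R axis i 1 + h *\<^sub>R axis j 1) - F (z + h *\<^sub>R axis i 1)
           - F (z + h *\<^sub>R axis j 1) + F z = h * h * partial j (partial i F) (?P s t)"
      using eq_s eq_t by simp
  qed
qed

text \<open>
  By the preceding lemma the two continuous functions \<open>?a\<close> and \<open>?b\<close> below take a common value
  at points arbitrarily close to \<open>z\<close>.
\<close>

lemma partial_commute:
  fixes F :: "real^'n \<Rightarrow> real"
  assumes "open S" "smooth_on S F" "z \<in> S"
  shows "partial i (partial j F) z = partial j (partial i F) z"
proof (rule ccontr)
  let ?a = "partial i (partial j F)" and ?b = "partial j (partial i F)"
  define e where "e = \<bar>?a z - ?b z\<bar> / 2"
  assume "?a z \<noteq> ?b z"
  then have "e > 0" by (simp add: e_def)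
  have "isCont ?a z" "isCont ?b z"
    using assms by (auto intro!: smooth_on_continuous_at[OF assms(1)] smooth_on_partial)
  then obtain u v where uv: "u > 0" "v > 0"
    and u: "\<And>q. dist q z < u \<Longrightarrow> dist (?a q) (?a z) < e"
    and v: "\<And>q. dist q z < v \<Longrightarrow> dist (?b q) (?b z) < e"
    using \<open>e > 0\<close> unfolding continuous_at_eps_delta by metis
  obtain \<epsilon> where "\<epsilon> > 0" "ball z \<epsilon> \<subseteq> S"
    using assms(1,3) openE by blast
  define h where "h = min \<epsilon> (min u v) / 3"
  have h: "h > 0" "2 * h < \<epsilon>" "2 * h < u" "2 * h < v"
    using uv \<open>\<epsilon> > 0\<close> by (auto simp: h_def)
  obtain p where p: "p \<in> cball z (2 * h)"
    and eq_p: "F (z + h *\<^sub>R axis j 1 + h *\<^sub>R axis i 1) - F (z + h *\<^sub>R axis j 1)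
           - F (z + h *\<^sub>R axis i 1) + F z = h * h * ?a p"
    using second_difference_mean_value[OF assms(2,1) \<open>ball z \<epsilon> \<subseteq> S\<close> h(1,2)] by metis
  obtain q where q: "q \<in> cball z (2 * h)"
    and eq_q: "F (z + h *\<^sub>R axis i 1 + h *\<^sub>R axis j 1) - F (z + h *\<^sub>R axis i 1)
           - F (z + h *\<^sub>R axis j 1) + F z = h * h * ?b q"
    using second_difference_mean_value[OF assms(2,1) \<open>ball z \<epsilon> \<subseteq> S\<close> h(1,2)] by metis
  have "h * h * ?a p = h * h * ?b q"
    using eq_p eq_q by (simp add: algebra_simps)
  then have "?a p = ?b q" using h(1) by simp
  moreover have "dist (?a p) (?a z) < e" "dist (?b q) (?b z) < e"
    using p q h u v by (auto simp: dist_commute)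
  ultimately show False
    using \<open>e > 0\<close> unfolding e_def dist_real_def by (smt (verit) field_sum_of_halves)
qed

section \<open>The two blocks of the metric\<close>

lemma vector_4 [simp]:
  "(vector [w, x, y, z] :: 'a::zero^4) $ 1 = w"
  "(vector [w, x, y, z] :: 'a::zero^4) $ 2 = x"
  "(vector [w, x, y, z] :: 'a::zero^4) $ 3 = y"
  "(vector [w, x, y, z] :: 'a::zero^4) $ 4 = z"
  unfolding vector_def by simp_all

lemma bounded_linear_xy: "bounded_linear xy"
proof -
  have "linear xy"
    by (intro linearI) (simp_all add: xy_def vec_eq_iff forall_2)
  then show ?thesis by (rule linear_conv_bounded_linear[THEN iffD1])
qed

lemma has_partial_xy:
  assumes "open S" "smooth_on S \<phi>" "xy p \<in> S"
  shows "has_partial (\<lambda>p. \<phi> (xy p))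
    (vector [0, 0, partial 1 \<phi> (xy p), partial 2 \<phi> (xy p)] $ i) i p"
proof -
  have "xy (p + s *\<^sub>R axis 3 1) = xy p + s *\<^sub>R axis 1 1"
    "xy (p + s *\<^sub>R axis 4 1) = xy p + s *\<^sub>R axis 2 1"
    "xy (p + s *\<^sub>R axis 1 1) = xy p" "xy (p + s *\<^sub>R axis 2 1) = xy p" for s
    by (simp_all add: xy_def vec_eq_iff forall_2 axis_def)
  then have "\<forall>i. has_partial (\<lambda>p. \<phi> (xy p))
    (vector [0, 0, partial 1 \<phi> (xy p), partial 2 \<phi> (xy p)] $ i) i p"
    using smooth_on_has_partial[OF assms(2,3)] by (simp add: forall_4 has_partial_def)
  then show ?thesis ..
qed

text \<open>The component \<open>g\<^sub>1\<^sub>1\<close> as a function of \<open>r\<close>, and its derivative.\<close>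

definition rt_A :: "real \<Rightarrow> real \<Rightarrow> real \<Rightarrow> real \<Rightarrow> real" where
  "rt_A a b d r = - 2 * (a - 2*b*r - d/r)"

definition rt_A' :: "real \<Rightarrow> real \<Rightarrow> real \<Rightarrow> real" where
  "rt_A' b d r = 4*b - 2*d/r\<^sup>2"

definition base_block :: "real \<Rightarrow> real^4^4" where
  "base_block A = vector [vector [A, 1, 0, 0], vector [1, 0, 0, 0], 0, 0]"

definition fibre_block :: "real \<Rightarrow> real^4^4" where
  "fibre_block h = vector [0, 0, vector [0, 0, h, 0], vector [0, 0, 0, h]]"

definition rt_base :: "real \<Rightarrow> real \<Rightarrow> real \<Rightarrow> 4 tensor02" where
  "rt_base a b d p = base_block (rt_A a b d (p $ 2))"

definition rt_fibre :: "(real^2 \<Rightarrow> real) \<Rightarrow> 4 tensor02" where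
  "rt_fibre f p = fibre_block (- ((p $ 2)\<^sup>2 / (f (xy p))\<^sup>2))"

lemma rt_metric_split: "rt_metric a b d f p = rt_base a b d p + rt_fibre f p"
  by (simp add: rt_metric_def rt_base_def rt_fibre_def base_block_def fibre_block_def rt_A_def
      vec_eq_iff forall_4 Let_def)

lemma matrix_inv_unique:
  fixes A B :: "real^'n^'n"
  assumes "A ** B = mat 1"
  shows "matrix_inv A = B"
proof -
  have "invertible A"
    using assms by (auto simp: invertible_right_inverse)
  then have "matrix_inv A ** A = mat 1"
    unfolding invertible_def matrix_inv_def by (metis (mono_tags, lifting) someI_ex)
  then show ?thesis
    by (metis assms matrix_mul_assoc matrix_mul_lid matrix_mul_rid)
qed

lemma matrix_inv_rt_metric:
  assumes "p $ 2 \<noteq> 0" "f (xy p) \<noteq> 0"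
  shows "matrix_inv (rt_metric a b d f p) =
    (let h = - ((f (xy p))\<^sup>2 / (p $ 2)\<^sup>2) in
     vector [vector [0, 1, 0, 0],
             vector [1, - rt_A a b d (p $ 2), 0, 0],
             vector [0, 0, h, 0],
             vector [0, 0, 0, h]])"
  using assms
  by (intro matrix_inv_unique)
     (simp add: rt_metric_def rt_A_def vec_eq_iff forall_4 matrix_matrix_mult_def sum_4 mat_def Let_def)

lemma has_partial_kulkarni_nomizu:
  assumes "\<And>i j. has_partial (\<lambda>p. \<phi> p $ i $ j) (\<alpha> * \<phi> p $ i $ j) l p"
    and "\<And>i j. has_partial (\<lambda>p. \<psi> p $ i $ j) (\<beta> * \<psi> p $ i $ j) l p"
  shows "has_partial (kulkarni_nomizu \<phi> \<psi> i j s t) ((\<alpha> + \<beta>) * kulkarni_nomizu \<phi> \<psi> i j s t p) l p"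
  unfolding kulkarni_nomizu_def
  by (rule has_partial_eq_rhs, (rule has_partial_add has_partial_diff has_partial_mult assms)+)
     (simp add: algebra_simps)

text \<open>The coefficient \<open>x + y\<close> uses the symmetry of the Kulkarni-Nomizu product.\<close>

lemma kulkarni_nomizu_lincomb:
  assumes "\<phi> p = \<phi>1 p + \<phi>2 p" "\<psi> p = x *\<^sub>R \<phi>1 p + y *\<^sub>R \<phi>2 p"
  shows "kulkarni_nomizu \<phi> \<psi> i j s t p = x * kulkarni_nomizu \<phi>1 \<phi>1 i j s t p
    + (x + y) * kulkarni_nomizu \<phi>1 \<phi>2 i j s t p + y * kulkarni_nomizu \<phi>2 \<phi>2 i j s t p"
  by (simp add: kulkarni_nomizu_def assms algebra_simps)

section \<open>Christoffel symbols and curvature\<close>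

text \<open>
  The pattern of the Christoffel symbols of a metric with blocks \<open>k\<close> and \<open>m\<close>: the entry in
  position \<open>i\<close>, \<open>j\<close>, \<open>l\<close> has upper index \<open>i\<close>. Because the pattern is linear in its seven
  parameters, the partial derivatives of the Christoffel symbols follow the same pattern, with
  differentiated parameters.
\<close>

definition christoffel_shape ::
    "real \<Rightarrow> real \<Rightarrow> real \<Rightarrow> real \<Rightarrow> real \<Rightarrow> real \<Rightarrow> real \<Rightarrow> real^4^4^4" where
  "christoffel_shape P Q w v q X Y = vector [
     vector [vector [- P, 0, 0, 0], 0, vector [0, 0, w, 0], vector [0, 0, 0, w]],
     vector [vector [Q, P, 0, 0], vector [P, 0, 0, 0], vector [0, 0, v, 0], vector [0, 0, 0, v]],
     vector [0, vector [0, 0, q, 0], vector [0, q, - X, - Y], vector [0, 0, - Y, X]],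
     vector [0, vector [0, 0, 0, q], vector [0, 0, Y, - X], vector [0, q, - X, - Y]]]"

lemma christoffel_shape_nth:
  "christoffel_shape P Q w v q X Y $ 1 $ 1 = vector [- P, 0, 0, 0]"
  "christoffel_shape P Q w v q X Y $ 1 $ 2 = 0"
  "christoffel_shape P Q w v q X Y $ 1 $ 3 = vector [0, 0, w, 0]"
  "christoffel_shape P Q w v q X Y $ 1 $ 4 = vector [0, 0, 0, w]"
  "christoffel_shape P Q w v q X Y $ 2 $ 1 = vector [Q, P, 0, 0]"
  "christoffel_shape P Q w v q X Y $ 2 $ 2 = vector [P, 0, 0, 0]"
  "christoffel_shape P Q w v q X Y $ 2 $ 3 = vector [0, 0, v, 0]"
  "christoffel_shape P Q w v q X Y $ 2 $ 4 = vector [0, 0, 0, v]"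
  "christoffel_shape P Q w v q X Y $ 3 $ 1 = 0"
  "christoffel_shape P Q w v q X Y $ 3 $ 2 = vector [0, 0, q, 0]"
  "christoffel_shape P Q w v q X Y $ 3 $ 3 = vector [0, q, - X, - Y]"
  "christoffel_shape P Q w v q X Y $ 3 $ 4 = vector [0, 0, - Y, X]"
  "christoffel_shape P Q w v q X Y $ 4 $ 1 = 0"
  "christoffel_shape P Q w v q X Y $ 4 $ 2 = vector [0, 0, 0, q]"
  "christoffel_shape P Q w v q X Y $ 4 $ 3 = vector [0, 0, Y, - X]"
  "christoffel_shape P Q w v q X Y $ 4 $ 4 = vector [0, q, - X, - Y]"
  by (simp_all add: christoffel_shape_def)

lemma has_partial_christoffel_shape:
  assumes "has_partial P P' l p" "has_partial Q Q' l p" "has_partial w w' l p"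
    "has_partial v v' l p" "has_partial q q' l p" "has_partial X X' l p" "has_partial Y Y' l p"
  shows "has_partial (\<lambda>p. christoffel_shape (P p) (Q p) (w p) (v p) (q p) (X p) (Y p) $ i $ j $ k)
    (christoffel_shape P' Q' w' v' q' X' Y' $ i $ j $ k) l p"
proof -
  have "\<forall>i j k. has_partial
      (\<lambda>p. christoffel_shape (P p) (Q p) (w p) (v p) (q p) (X p) (Y p) $ i $ j $ k)
      (christoffel_shape P' Q' w' v' q' X' Y' $ i $ j $ k) l p"
    by (simp add: christoffel_shape_nth forall_4 assms has_partial_const has_partial_minus)
  then show ?thesis by blast
qed

definition gamma_table :: "real \<Rightarrow> real \<Rightarrow> real \<Rightarrow> real \<Rightarrow> real \<Rightarrow> real \<Rightarrow> real^4^4^4" where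
  "gamma_table r F fx fy A A' =
    christoffel_shape (A'/2) (A*A'/2) (r/F\<^sup>2) (- (A*r/F\<^sup>2)) (1/r) (fx/F) (fy/F)"

text \<open>The first index is the direction of differentiation.\<close>

definition dgamma_table :: "real \<Rightarrow> real \<Rightarrow> real \<Rightarrow> real \<Rightarrow> real \<Rightarrow> real \<Rightarrow> real
    \<Rightarrow> real \<Rightarrow> real \<Rightarrow> real \<Rightarrow> real^4^4^4^4" where
  "dgamma_table r F fx fy fxx fxy fyy A A' A'' = vector [
     christoffel_shape 0 0 0 0 0 0 0,
     christoffel_shape (A''/2) ((A'*A' + A*A'')/2) (1/F\<^sup>2) (- ((A + r*A')/F\<^sup>2)) (- (1/r\<^sup>2)) 0 0,
     christoffel_shape 0 0 (- (2*r*fx/F^3)) (2*A*r*fx/F^3) 0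
       ((fxx*F - fx*fx)/F\<^sup>2) ((fxy*F - fx*fy)/F\<^sup>2),
     christoffel_shape 0 0 (- (2*r*fy/F^3)) (2*A*r*fy/F^3) 0
       ((fxy*F - fx*fy)/F\<^sup>2) ((fyy*F - fy*fy)/F\<^sup>2)]"

text \<open>
  The left hand side is the definition of the curvature tensor with all derivatives replaced by
  independent real numbers, so only rational algebra remains. The identity holds for any profile
  \<open>A = g\<^sub>1\<^sub>1\<close> of the base metric. The coefficient of \<open>k \<and> k\<close> is a multiple of the Gaussian
  curvature of the base, that of \<open>k \<and> m\<close> is the factor by which the Hessian of \<open>r\<close> is proportional
  to \<open>k\<close>, divided by \<open>r\<close>, and in that of \<open>m \<and> m\<close> the curvature of \<open>(dx\<^sup>2 + dy\<^sup>2) / f\<^sup>2\<close> is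
  corrected by the squared gradient of \<open>r\<close>, which is \<open>- A\<close>.
\<close>

lemma riemann_algebra:
  fixes r F fx fy fxx fxy fyy A A' A'' :: real
  assumes "r \<noteq> 0" "F \<noteq> 0"
  defines "h \<equiv> - (r\<^sup>2 / F\<^sup>2)"
  defines "k \<equiv> \<lambda>_::real^4. base_block A"
    and "m \<equiv> \<lambda>_::real^4. fibre_block h"
    and "G \<equiv> gamma_table r F fx fy A A'"
    and "dG \<equiv> dgamma_table r F fx fy fxx fxy fyy A A' A''"
  shows "(\<Sum>i\<in>UNIV. (k z + m z) $ p $ i * (dG $ u $ i $ q $ s - dG $ s $ i $ q $ u
        + (\<Sum>j\<in>UNIV. G $ j $ q $ s * G $ i $ j $ u - G $ j $ q $ u * G $ i $ j $ s)))
    = - (A''/4) * kulkarni_nomizu k k p q u s z - A'/(2*r) * kulkarni_nomizu k m p q u s z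
      - (fx\<^sup>2 + fy\<^sup>2 - F*(fxx + fyy) + A)/(2*r\<^sup>2) * kulkarni_nomizu m m p q u s z"
proof -
  \<comment> \<open>Naming the claim keeps the 256 instances small until each one is evaluated separately.\<close>
  define claim where "claim p q u s \<longleftrightarrow>
    (\<Sum>i\<in>UNIV. (k z + m z) $ p $ i * (dG $ u $ i $ q $ s - dG $ s $ i $ q $ u
        + (\<Sum>j\<in>UNIV. G $ j $ q $ s * G $ i $ j $ u - G $ j $ q $ u * G $ i $ j $ s)))
    = - (A''/4) * kulkarni_nomizu k k p q u s z - A'/(2*r) * kulkarni_nomizu k m p q u s z
      - (fx\<^sup>2 + fy\<^sup>2 - F*(fxx + fyy) + A)/(2*r\<^sup>2) * kulkarni_nomizu m m p q u s z" for p q u s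
  note components = claim_def sum_4 dG_def dgamma_table_def G_def gamma_table_def
    christoffel_shape_nth vector_4 kulkarni_nomizu_def k_def m_def base_block_def fibre_block_def
    zero_index vector_add_component
  have "\<forall>p q u s. claim p q u s"
    unfolding forall_4
    apply (intro conjI)
    apply (simp_all only: components mult_zero_left mult_zero_right add_0 add_0_right diff_self
        diff_zero minus_zero)
    apply (simp_all add: assms(1,2))
    apply (simp_all add: h_def assms(1,2) divide_simps)
    apply (simp_all add: algebra_simps power2_eq_square power3_eq_cube power4_eq_xxxx)
    done
  then show ?thesis by (simp add: claim_def)
qed

section \<open>The curvature of the Robinson-Trautman metric\<close>

locale robinson_trautman =
  fixes a b d :: real and f :: "real^2 \<Rightarrow> real" and \<Omega> :: "(real^2) set" and M :: "(real^4) set"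
  assumes open_M: "open M" and open_\<Omega>: "open \<Omega>" and smooth_f: "smooth_on \<Omega> f"
    and f_nz: "\<And>u. u \<in> \<Omega> \<Longrightarrow> f u \<noteq> 0"
    and r_nz: "\<And>p. p \<in> M \<Longrightarrow> p $ 2 \<noteq> 0"
    and xy_in: "\<And>p. p \<in> M \<Longrightarrow> xy p \<in> \<Omega>"
begin

abbreviation "g \<equiv> rt_metric a b d f"
abbreviation "k \<equiv> rt_base a b d"
abbreviation "m \<equiv> rt_fibre f"
abbreviation "A p \<equiv> rt_A a b d (p $ 2)"
abbreviation "A' p \<equiv> rt_A' b d (p $ 2)"
abbreviation "F p \<equiv> f (xy p)"
abbreviation "Fx p \<equiv> partial 1 f (xy p)"
abbreviation "Fy p \<equiv> partial 2 f (xy p)"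
abbreviation "Fxx p \<equiv> partial 1 (partial 1 f) (xy p)"
abbreviation "Fxy p \<equiv> partial 2 (partial 1 f) (xy p)"
abbreviation "Fyy p \<equiv> partial 2 (partial 2 f) (xy p)"
abbreviation "Fxxx p \<equiv> partial 1 (partial 1 (partial 1 f)) (xy p)"
abbreviation "Fxyy p \<equiv> partial 2 (partial 2 (partial 1 f)) (xy p)"

lemma F_nz: "p \<in> M \<Longrightarrow> F p \<noteq> 0"
  using f_nz xy_in by blast

lemma matrix_inv_g:
  assumes "p \<in> M"
  shows "matrix_inv (g p) =
    (let h = - ((F p)\<^sup>2 / (p $ 2)\<^sup>2) in
     vector [vector [0, 1, 0, 0], vector [1, - A p, 0, 0], vector [0, 0, h, 0], vector [0, 0, 0, h]])"
  by (rule matrix_inv_rt_metric[where f = f, OF r_nz[OF assms] F_nz[OF assms]])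

lemma smooth_xy: "smooth_on \<Omega> \<phi> \<Longrightarrow> smooth_on M (\<lambda>p. \<phi> (xy p))"
  using smooth_on_compose_linear[OF open_M bounded_linear_xy] xy_in by blast

lemmas smooth_partial = smooth_on_partial[OF open_\<Omega>]

lemma has_partial_xyM:
  "smooth_on \<Omega> \<phi> \<Longrightarrow> p \<in> M \<Longrightarrow> has_partial (\<lambda>p. \<phi> (xy p))
    (vector [0, 0, partial 1 \<phi> (xy p), partial 2 \<phi> (xy p)] $ i) i p"
  using has_partial_xy[OF open_\<Omega>] xy_in by blast

lemma partial_xy_commute: "p \<in> M \<Longrightarrow> partial 1 (partial 2 f) (xy p) = Fxy p"
  using partial_commute[OF open_\<Omega> smooth_f] xy_in by blast

text \<open>
  The derivative of \<open>F\<^sub>1\<close> in direction \<open>x\<close> contains \<open>\<partial>\<^sub>x \<partial>\<^sub>y \<partial>\<^sub>y f\<close>, whereas the coefficients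
  of the inheritance equation are written with \<open>\<partial>\<^sub>y \<partial>\<^sub>y \<partial>\<^sub>x f\<close>.
\<close>

lemma partial_xyy_commute:
  assumes "p \<in> M"
  shows "partial 1 (partial 2 (partial 2 f)) (xy p) = Fxyy p"
proof -
  have "partial 1 (partial 2 (partial 2 f)) (xy p) = partial 2 (partial 1 (partial 2 f)) (xy p)"
    using partial_commute[OF open_\<Omega> smooth_partial[OF smooth_f]] xy_in assms by blast
  also have "\<dots> = Fxyy p"
  proof (rule partial_eqI, rule has_partial_cong[OF _ open_\<Omega> xy_in[OF assms]])
    show "has_partial (partial 2 (partial 1 f)) (Fxyy p) 2 (xy p)"
      using smooth_on_has_partial xy_in assms smooth_f smooth_partial by blast
    show "partial 2 (partial 1 f) u = partial 1 (partial 2 f) u" if "u \<in> \<Omega>" for u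
      using partial_commute[OF open_\<Omega> smooth_f that] .
  qed
  finally show ?thesis .
qed

lemma has_partial_A:
  assumes "p \<in> M"
  shows "has_partial A (vector [0, A' p, 0, 0] $ l) l p"
proof -
  have "\<forall>l. has_partial A (vector [0, A' p, 0, 0] $ l) l p"
    unfolding forall_4 rt_A_def rt_A'_def
    by (intro conjI; rule has_partial_eq_rhs, (rule has_partial_intros r_nz[OF assms])+)
       (simp_all add: r_nz[OF assms] power2_eq_square field_simps)
  then show ?thesis ..
qed

lemma has_partial_A':
  assumes "p \<in> M"
  shows "has_partial A' (vector [0, 4*d/(p $ 2)^3, 0, 0] $ l) l p"
proof -
  have nz: "(p $ 2)\<^sup>2 \<noteq> 0" using r_nz[OF assms] by simp
  have "\<forall>l. has_partial A' (vector [0, 4*d/(p $ 2)^3, 0, 0] $ l) l p"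
    unfolding forall_4 rt_A'_def
    by (intro conjI; rule has_partial_eq_rhs, (rule has_partial_intros nz)+)
       (simp_all add: r_nz[OF assms] power2_eq_square power3_eq_cube field_simps)
  then show ?thesis ..
qed

lemma has_partial_base:
  assumes "p \<in> M"
  shows "has_partial (\<lambda>p. k p $ i $ j) (if l = 2 \<and> i = 1 \<and> j = 1 then A' p else 0) l p"
proof -
  have "\<forall>l i j. has_partial (\<lambda>p. k p $ i $ j) (if l = 2 \<and> i = 1 \<and> j = 1 then A' p else 0) l p"
    using has_partial_A[OF assms, of 1] has_partial_A[OF assms, of 2]
      has_partial_A[OF assms, of 3] has_partial_A[OF assms, of 4]
    by (simp add: forall_4 rt_base_def base_block_def has_partial_const)
  then show ?thesis by blast
qed

lemma has_partial_fibre: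
  assumes "p \<in> M"
  shows "has_partial (\<lambda>p. m p $ i $ j)
    (vector [0, 2 / p $ 2, - (2 * Fx p / F p), - (2 * Fy p / F p)] $ l * m p $ i $ j) l p"
proof -
  have nz: "(F p)\<^sup>2 \<noteq> 0" "F p \<noteq> 0" "p $ 2 \<noteq> 0" using F_nz r_nz assms by auto
  have "\<forall>l. has_partial (\<lambda>p. - ((p $ 2)\<^sup>2 / (F p)\<^sup>2))
    (vector [0, 2 / p $ 2, - (2 * Fx p / F p), - (2 * Fy p / F p)] $ l * (- ((p $ 2)\<^sup>2 / (F p)\<^sup>2))) l p"
    unfolding forall_4
    by (intro conjI; rule has_partial_eq_rhs,
        (rule has_partial_intros has_partial_xyM[OF smooth_f assms] nz)+)
       (simp_all add: nz power2_eq_square field_simps)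
  then have "\<forall>l i j. has_partial (\<lambda>p. m p $ i $ j)
    (vector [0, 2 / p $ 2, - (2 * Fx p / F p), - (2 * Fy p / F p)] $ l * m p $ i $ j) l p"
    by (simp add: forall_4 rt_fibre_def fibre_block_def has_partial_const)
  then show ?thesis by blast
qed

lemma partial_metric:
  assumes "p \<in> M"
  shows "partial l (\<lambda>p. g p $ i $ j) p = (if l = 2 \<and> i = 1 \<and> j = 1 then A' p else 0)
    + vector [0, 2 / p $ 2, - (2 * Fx p / F p), - (2 * Fy p / F p)] $ l * m p $ i $ j"
  unfolding rt_metric_split vector_add_component
  by (rule partial_eqI, rule has_partial_add[OF has_partial_base[OF assms] has_partial_fibre[OF assms]])

abbreviation "G p \<equiv> gamma_table (p $ 2) (F p) (Fx p) (Fy p) (A p) (A' p)"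
abbreviation "dG p \<equiv> dgamma_table (p $ 2) (F p) (Fx p) (Fy p) (Fxx p) (Fxy p) (Fyy p)
  (A p) (A' p) (4*d/(p $ 2)^3)"

lemma christoffel_eq:
  assumes "p \<in> M"
  shows "christoffel g i j l p = G p $ i $ j $ l"
proof -
  have nz: "F p \<noteq> 0" "p $ 2 \<noteq> 0" using F_nz r_nz assms by auto
  have "\<forall>i j l. christoffel g i j l p = G p $ i $ j $ l"
    unfolding christoffel_def partial_metric[OF assms] sum_4 matrix_inv_g[OF assms] Let_def
    by (simp add: forall_4 gamma_table_def christoffel_shape_nth rt_fibre_def fibre_block_def nz
        power2_eq_square)
  then show ?thesis by blast
qed

lemma partial_christoffel:
  assumes "p \<in> M"
  shows "partial l (christoffel g i j s) p = dG p $ l $ i $ j $ s"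
proof -
  have nz: "(F p)\<^sup>2 \<noteq> 0" "F p \<noteq> 0" "p $ 2 \<noteq> 0" "(2::real) \<noteq> 0" using F_nz r_nz assms by auto
  note rules = has_partial_intros has_partial_xyM[OF smooth_f assms]
    has_partial_xyM[OF smooth_partial[OF smooth_f] assms]
    has_partial_A[OF assms] has_partial_A'[OF assms] nz
  \<comment> \<open>The same table with the direction of differentiation moved inside each parameter.\<close>
  define D where "D l = christoffel_shape
    (vector [0, 2*d/(p $ 2)^3, 0, 0] $ l)
    (vector [0, (A' p*A' p + A p*(4*d/(p $ 2)^3))/2, 0, 0] $ l)
    (vector [0, 1/(F p)\<^sup>2, - (2*p $ 2*Fx p/(F p)^3), - (2*p $ 2*Fy p/(F p)^3)] $ l)
    (vector [0, - ((A p + p $ 2*A' p)/(F p)\<^sup>2), 2*A p*p $ 2*Fx p/(F p)^3,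
       2*A p*p $ 2*Fy p/(F p)^3] $ l)
    (vector [0, - (1/(p $ 2)\<^sup>2), 0, 0] $ l)
    (vector [0, 0, (Fxx p*F p - Fx p*Fx p)/(F p)\<^sup>2, (Fxy p*F p - Fx p*Fy p)/(F p)\<^sup>2] $ l)
    (vector [0, 0, (Fxy p*F p - Fx p*Fy p)/(F p)\<^sup>2, (Fyy p*F p - Fy p*Fy p)/(F p)\<^sup>2] $ l)"
    for l :: 4
  have "\<forall>l. has_partial (\<lambda>p. G p $ i $ j $ s) (D l $ i $ j $ s) l p"
    unfolding forall_4 D_def gamma_table_def
    by (intro conjI; rule has_partial_christoffel_shape;
        rule has_partial_eq_rhs, (rule rules)+)
       (simp_all add: nz power2_eq_square power3_eq_cube field_simps partial_xy_commute[OF assms])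
  then have "has_partial (\<lambda>p. G p $ i $ j $ s) (D l $ i $ j $ s) l p" ..
  then have "has_partial (christoffel g i j s) (D l $ i $ j $ s) l p"
    by (rule has_partial_cong[OF _ open_M assms]) (simp add: christoffel_eq)
  moreover have "\<forall>l. D l = dG p $ l"
    by (simp add: D_def dgamma_table_def forall_4)
  ultimately show ?thesis
    using partial_eqI by metis
qed

text \<open>The coefficients of \<open>k \<and> k\<close>, \<open>k \<and> m\<close> and \<open>m \<and> m\<close> in the curvature tensor.\<close>

definition "\<rho>1 p = - (d / (p $ 2)^3)" for p :: "real^4"
definition "\<rho>2 p = d / (p $ 2)^3 - 2 * b / p $ 2" for p :: "real^4"
definition "\<rho>3 p = - ((rt_F1 f p + A p) / (2 * (p $ 2)\<^sup>2))"

lemma riemann_eq: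
  assumes "p \<in> M"
  shows "riemann g i j s t p = \<rho>1 p * kulkarni_nomizu k k i j s t p
    + \<rho>2 p * kulkarni_nomizu k m i j s t p + \<rho>3 p * kulkarni_nomizu m m i j s t p"
proof -
  have nz: "F p \<noteq> 0" "p $ 2 \<noteq> 0" using F_nz r_nz assms by auto
  let ?h = "- ((p $ 2)\<^sup>2 / (F p)\<^sup>2)"
  have eqs: "\<rho>1 p = - (4*d/(p $ 2)^3 / 4)" "\<rho>2 p = - (A' p / (2 * p $ 2))"
    "\<rho>3 p = - (((Fx p)\<^sup>2 + (Fy p)\<^sup>2 - F p*(Fxx p + Fyy p) + A p) / (2 * (p $ 2)\<^sup>2))"
    by (simp_all add: \<rho>1_def \<rho>2_def \<rho>3_def rt_A'_def rt_F1_def Let_def nz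
        power2_eq_square power3_eq_cube field_simps)
  have KN: "kulkarni_nomizu k k i j s t p
      = kulkarni_nomizu (\<lambda>_. base_block (A p)) (\<lambda>_. base_block (A p)) i j s t p"
    "kulkarni_nomizu k m i j s t p
      = kulkarni_nomizu (\<lambda>_. base_block (A p)) (\<lambda>_. fibre_block ?h) i j s t p"
    "kulkarni_nomizu m m i j s t p
      = kulkarni_nomizu (\<lambda>_. fibre_block ?h) (\<lambda>_. fibre_block ?h) i j s t p"
    by (simp_all add: kulkarni_nomizu_def rt_base_def rt_fibre_def)
  show ?thesis
    unfolding riemann_def partial_christoffel[OF assms] christoffel_eq[OF assms] rt_metric_split
      rt_base_def[of a b d p] rt_fibre_def[of f p] eqs KN
    by (subst riemann_algebra[OF nz(2) nz(1)]) simp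
qed

text \<open>
  The contraction sends \<open>k \<and> k\<close> to \<open>2 k\<close>, \<open>m \<and> m\<close> to \<open>2 m\<close> and \<open>k \<and> m\<close> to \<open>2 (k + m)\<close>,
  because both blocks are two-dimensional.
\<close>

lemma ricci_eq:
  assumes "p \<in> M"
  shows "ricci g p = (2 * (\<rho>1 p + \<rho>2 p)) *\<^sub>R k p + (2 * (\<rho>2 p + \<rho>3 p)) *\<^sub>R m p"
proof -
  have nz: "F p \<noteq> 0" "p $ 2 \<noteq> 0" using F_nz r_nz assms by auto
  show ?thesis
    unfolding ricci_def riemann_eq[OF assms] sum_4 kulkarni_nomizu_def vec_eq_iff
      matrix_inv_g[OF assms] Let_def rt_base_def rt_fibre_def
      base_block_def fibre_block_def
    by (simp add: forall_4) (simp add: nz field_simps)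
qed

lemma scalar_eq:
  assumes "p \<in> M"
  shows "scalar_curv g p = 4 * \<rho>1 p + 8 * \<rho>2 p + 4 * \<rho>3 p"
proof -
  have nz: "F p \<noteq> 0" "p $ 2 \<noteq> 0" using F_nz r_nz assms by auto
  show ?thesis
    unfolding scalar_curv_def ricci_eq[OF assms] sum_4
      matrix_inv_g[OF assms] Let_def rt_base_def rt_fibre_def
      base_block_def fibre_block_def
    by (simp add: nz field_simps)
qed

end

section \<open>The inheritance equation\<close>

text \<open>For a coordinate vector field only the transport term of the Lie derivative survives.\<close>

lemma lie_derivative_axis:
  "lie_derivative (\<lambda>p. axis l 1) T i j s t p = partial l (T i j s t) p"
proof -
  have "partial i (\<lambda>w. c) p = 0" for i c
    by (rule partial_eqI) (rule has_partial_const)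
  then have "lie_derivative (\<lambda>p. axis l 1) T i j s t p
      = (\<Sum>n\<in>UNIV. (if n = l then partial n (T i j s t) p else 0))"
    unfolding lie_derivative_def by (intro sum.cong) (auto simp: axis_def)
  then show ?thesis by simp
qed

text \<open>
  The three equations compare the coefficients of \<open>k \<and> k\<close>, \<open>k \<and> m\<close> and \<open>m \<and> m\<close>. They are linear
  in \<open>X = \<partial>\<^sub>x F\<^sub>1\<close> and \<open>y = f\<^sub>x / f\<close>, and \<open>N\<close> is \<open>F\<^sub>4 / f\<close>. Eliminating \<open>a\<close> and \<open>d\<close> in favour of
  \<open>D\<close> and \<open>E\<close> makes all the variables independent.
\<close>

lemma inheritance_algebra:
  fixes b r D E X y :: real
  assumes nz: "r \<noteq> 0" "D \<noteq> 0" "E \<noteq> 0"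
  defines "N \<equiv> r*X - 2*(E + r*D)*y"
  defines "L \<equiv> N/E"
    and "L1 \<equiv> (8*b*r*E - (D + 8*b*r)*(3*r*D - 2*E))*N/(12*r^3*D*E)
      + (D + 8*b*r)*X/(12*r\<^sup>2*D) + 2*b*(2*y*E - r*X)/(3*r\<^sup>2*D)"
    and "L2 \<equiv> y*E/(3*r*D) + (E - r*D)*N/(2*r*D*E)"
  shows "X/(12*r\<^sup>2) = L*(D/(4*r\<^sup>2) - E/(6*r^3)) + L1 - L2*(4*b/r)"
    and "X/(6*r\<^sup>2) - 2*y*(E/(6*r^3)) = L*(E/(6*r^3)) + 2*L1 - L2*(8*b/r + D/r\<^sup>2)"
    and "- 5*X/(12*r\<^sup>2) + 4*y*(D/(4*r\<^sup>2) + E/(6*r^3))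
      = - L*(D/(4*r\<^sup>2) + E/(6*r^3)) + L1 - L2*(4*b/r + D/r\<^sup>2)"
proof -
  show "X/(12*r\<^sup>2) = L*(D/(4*r\<^sup>2) - E/(6*r^3)) + L1 - L2*(4*b/r)"
    unfolding L_def L1_def L2_def using nz
    by (simp add: divide_simps power2_eq_square power3_eq_cube) (simp add: N_def algebra_simps)
  show "X/(6*r\<^sup>2) - 2*y*(E/(6*r^3)) = L*(E/(6*r^3)) + 2*L1 - L2*(8*b/r + D/r\<^sup>2)"
    unfolding L_def L1_def L2_def using nz
    by (simp add: divide_simps power2_eq_square power3_eq_cube) (simp add: N_def algebra_simps)
  show "- 5*X/(12*r\<^sup>2) + 4*y*(D/(4*r\<^sup>2) + E/(6*r^3))
      = - L*(D/(4*r\<^sup>2) + E/(6*r^3)) + L1 - L2*(4*b/r + D/r\<^sup>2)"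
    unfolding L_def L1_def L2_def using nz
    by (simp add: divide_simps power2_eq_square power3_eq_cube) (simp add: N_def algebra_simps)
qed

context robinson_trautman
begin

text \<open>The amplitudes of the trace-free Ricci tensor and of the Weyl tensor.\<close>

definition "ricci_amp p = rt_F1 f p - 2*a + 4*b*p $ 2"
definition "weyl_amp p = p $ 2 * rt_F1 f p - 2*a*p $ 2 + 6*d"

text \<open>
  The first two are the eigenvalues of the Ricci tensor on the blocks, the others the coefficients
  of \<open>W\<close>. The numbers 24 and 12 arise from the factor \<open>1/24\<close> of \<open>\<kappa> g \<and> g\<close> and from
  \<open>g \<and> g = k \<and> k + 2 k \<and> m + m \<and> m\<close>. All five are linear in \<open>\<beta>\<close>, \<open>\<delta>\<close> and \<open>\<epsilon>\<close> below.
\<close>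

lemma curvature_coefficients:
  assumes "p \<in> M"
  shows "2*(\<rho>1 p + \<rho>2 p) = - (4*b/p $ 2)"
    and "2*(\<rho>2 p + \<rho>3 p) = - (4*b/p $ 2 + ricci_amp p/(p $ 2)\<^sup>2)"
    and "\<rho>1 p - (4*\<rho>1 p + 8*\<rho>2 p + 4*\<rho>3 p)/24 = ricci_amp p/(4*(p $ 2)\<^sup>2) - weyl_amp p/(6*(p $ 2)^3)"
    and "\<rho>2 p - (4*\<rho>1 p + 8*\<rho>2 p + 4*\<rho>3 p)/12 = weyl_amp p/(6*(p $ 2)^3)"
    and "\<rho>3 p - (4*\<rho>1 p + 8*\<rho>2 p + 4*\<rho>3 p)/24
      = - (ricci_amp p/(4*(p $ 2)\<^sup>2) + weyl_amp p/(6*(p $ 2)^3))"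
proof -
  define \<beta> \<delta> \<epsilon> where "\<beta> = b/p $ 2" and "\<delta> = d/(p $ 2)^3" and "\<epsilon> = ricci_amp p/(p $ 2)\<^sup>2"
  have weyl: "weyl_amp p/(p $ 2)^3 = \<epsilon> - 4*\<beta> + 6*\<delta>"
    using r_nz[OF assms]
    by (simp add: weyl_amp_def ricci_amp_def \<beta>_def \<delta>_def \<epsilon>_def field_simps power2_eq_square
        power3_eq_cube)
  have \<rho>: "\<rho>1 p = - \<delta>" "\<rho>2 p = \<delta> - 2*\<beta>" "\<rho>3 p = - (\<epsilon>/2) - \<delta>"
    using r_nz[OF assms]
    by (simp_all add: \<rho>1_def \<rho>2_def \<rho>3_def rt_A_def ricci_amp_def \<beta>_def \<delta>_def \<epsilon>_def field_simps
        power2_eq_square power3_eq_cube)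
  have fractions: "4*b/p $ 2 = 4*\<beta>" "ricci_amp p/(4*(p $ 2)\<^sup>2) = \<epsilon>/4"
    "weyl_amp p/(6*(p $ 2)^3) = (\<epsilon> - 4*\<beta> + 6*\<delta>)/6"
    unfolding weyl[symmetric] by (simp_all add: \<beta>_def \<epsilon>_def)
  show "2*(\<rho>1 p + \<rho>2 p) = - (4*b/p $ 2)"
    "2*(\<rho>2 p + \<rho>3 p) = - (4*b/p $ 2 + ricci_amp p/(p $ 2)\<^sup>2)"
    "\<rho>1 p - (4*\<rho>1 p + 8*\<rho>2 p + 4*\<rho>3 p)/24 = ricci_amp p/(4*(p $ 2)\<^sup>2) - weyl_amp p/(6*(p $ 2)^3)"
    "\<rho>2 p - (4*\<rho>1 p + 8*\<rho>2 p + 4*\<rho>3 p)/12 = weyl_amp p/(6*(p $ 2)^3)"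
    "\<rho>3 p - (4*\<rho>1 p + 8*\<rho>2 p + 4*\<rho>3 p)/24
      = - (ricci_amp p/(4*(p $ 2)\<^sup>2) + weyl_amp p/(6*(p $ 2)^3))"
    unfolding \<rho> fractions \<epsilon>_def[symmetric] by (simp_all add: field_simps)
qed

lemma kulkarni_nomizu_metric:
  "kulkarni_nomizu g g i j s t p = kulkarni_nomizu k k i j s t p
    + 2 * kulkarni_nomizu k m i j s t p + kulkarni_nomizu m m i j s t p"
  using kulkarni_nomizu_lincomb[of g p k m g 1 1] by (simp add: rt_metric_split)

lemma kulkarni_nomizu_metric_ricci:
  assumes "p \<in> M"
  shows "kulkarni_nomizu g (ricci g) i j s t p
    = - (4*b/p $ 2) * kulkarni_nomizu k k i j s t p
    - (8*b/p $ 2 + ricci_amp p/(p $ 2)\<^sup>2) * kulkarni_nomizu k m i j s t p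
    - (4*b/p $ 2 + ricci_amp p/(p $ 2)\<^sup>2) * kulkarni_nomizu m m i j s t p"
  using kulkarni_nomizu_lincomb[of g p k m "ricci g", OF rt_metric_split ricci_eq[OF assms], of i j s t]
  unfolding curvature_coefficients[OF assms] by (simp add: algebra_simps)

lemma concircular_eq:
  assumes "p \<in> M"
  shows "concircular g i j s t p
    = (ricci_amp p/(4*(p $ 2)\<^sup>2) - weyl_amp p/(6*(p $ 2)^3)) * kulkarni_nomizu k k i j s t p
    + weyl_amp p/(6*(p $ 2)^3) * kulkarni_nomizu k m i j s t p
    - (ricci_amp p/(4*(p $ 2)\<^sup>2) + weyl_amp p/(6*(p $ 2)^3)) * kulkarni_nomizu m m i j s t p"
proof -
  have "concircular g i j s t p
    = (\<rho>1 p - (4*\<rho>1 p + 8*\<rho>2 p + 4*\<rho>3 p)/24) * kulkarni_nomizu k k i j s t p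
    + (\<rho>2 p - (4*\<rho>1 p + 8*\<rho>2 p + 4*\<rho>3 p)/12) * kulkarni_nomizu k m i j s t p
    + (\<rho>3 p - (4*\<rho>1 p + 8*\<rho>2 p + 4*\<rho>3 p)/24) * kulkarni_nomizu m m i j s t p"
    by (simp add: concircular_def riemann_eq[OF assms] scalar_eq[OF assms] kulkarni_nomizu_metric)
       (simp add: algebra_simps add_divide_distrib)
  then show ?thesis
    unfolding curvature_coefficients[OF assms] by (simp add: algebra_simps)
qed

text \<open>
  The derivative of \<open>F\<^sub>1\<close> in direction \<open>x\<close>, with the mixed derivatives in the order used by the
  coefficients of the inheritance equation.
\<close>

definition "F1x p = Fx p * Fxx p + 2 * Fy p * Fxy p - Fx p * Fyy p - F p * (Fxxx p + Fxyy p)"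

lemma has_partial_F1:
  assumes "p \<in> M"
  shows "has_partial (rt_F1 f) (F1x p) 3 p"
  unfolding rt_F1_def Let_def
  by (rule has_partial_eq_rhs, (rule has_partial_intros has_partial_xyM smooth_f smooth_partial assms)+)
     (simp add: F1x_def partial_xy_commute partial_xyy_commute assms algebra_simps)

lemma has_partial_amplitudes:
  assumes "p \<in> M"
  shows "has_partial ricci_amp (F1x p) 3 p" "has_partial weyl_amp (p $ 2 * F1x p) 3 p"
  unfolding ricci_amp_def[abs_def] weyl_amp_def[abs_def]
  by (rule has_partial_eq_rhs, (rule has_partial_intros has_partial_F1[OF assms])+; simp)+

text \<open>
  The tensors \<open>k \<and> k\<close>, \<open>k \<and> m\<close> and \<open>m \<and> m\<close> are eigenvectors of \<open>\<partial>/\<partial>x\<close>, with eigenvalues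
  \<open>0\<close>, \<open>- 2 f\<^sub>x / f\<close> and \<open>- 4 f\<^sub>x / f\<close>.
\<close>

lemma lie_concircular_eq:
  assumes "p \<in> M"
  defines "D \<equiv> ricci_amp p" and "E \<equiv> weyl_amp p" and "r \<equiv> p $ 2"
    and "X \<equiv> F1x p" and "y \<equiv> Fx p / F p"
  shows "lie_derivative (\<lambda>p. axis 3 1) (concircular g) i j s t p
    = X/(12*r\<^sup>2) * kulkarni_nomizu k k i j s t p
    + (X/(6*r\<^sup>2) - 2*y*(E/(6*r^3))) * kulkarni_nomizu k m i j s t p
    + (- 5*X/(12*r\<^sup>2) + 4*y*(D/(4*r\<^sup>2) + E/(6*r^3))) * kulkarni_nomizu m m i j s t p"
    (is "_ = ?rhs")
proof -
  have nz: "4 * (p $ 2)\<^sup>2 \<noteq> 0" "6 * (p $ 2)^3 \<noteq> 0" using r_nz assms by auto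
  have k: "has_partial (\<lambda>p. k p $ i $ j) (0 * k p $ i $ j) 3 p" for i j
    using has_partial_base[OF assms(1), of i j 3] by simp
  have m: "has_partial (\<lambda>p. m p $ i $ j) (- 2 * y * m p $ i $ j) 3 p" for i j
    using has_partial_fibre[OF assms(1), of i j 3] by (simp add: y_def)
  note amp = has_partial_amplitudes[OF assms(1)]
  have u: "has_partial (\<lambda>p. ricci_amp p/(4*(p $ 2)\<^sup>2)) (X/(4*r\<^sup>2)) 3 p"
    by (rule has_partial_eq_rhs, (rule has_partial_intros amp nz)+)
       (use r_nz[OF assms(1)] in \<open>simp add: X_def r_def field_simps power2_eq_square\<close>)
  have v: "has_partial (\<lambda>p. weyl_amp p/(6*(p $ 2)^3)) (X/(6*r\<^sup>2)) 3 p"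
    by (rule has_partial_eq_rhs, (rule has_partial_intros amp nz)+)
       (use r_nz[OF assms(1)] in
         \<open>simp add: X_def r_def field_simps power2_eq_square power3_eq_cube\<close>)
  have "has_partial (\<lambda>p.
      (ricci_amp p/(4*(p $ 2)\<^sup>2) - weyl_amp p/(6*(p $ 2)^3)) * kulkarni_nomizu k k i j s t p
    + weyl_amp p/(6*(p $ 2)^3) * kulkarni_nomizu k m i j s t p
    - (ricci_amp p/(4*(p $ 2)\<^sup>2) + weyl_amp p/(6*(p $ 2)^3)) * kulkarni_nomizu m m i j s t p)
    ?rhs 3 p"
    by (rule has_partial_eq_rhs, (rule u v has_partial_add has_partial_diff has_partial_mult
        has_partial_kulkarni_nomizu[OF k k] has_partial_kulkarni_nomizu[OF k m]
        has_partial_kulkarni_nomizu[OF m m])+)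
       (simp add: D_def[symmetric] E_def[symmetric] r_def[symmetric], simp add: algebra_simps)
  then have "has_partial (concircular g i j s t) ?rhs 3 p"
    by (rule has_partial_cong[OF _ open_M assms(1)]) (simp add: concircular_eq)
  then show ?thesis
    unfolding lie_derivative_axis by (rule partial_eqI)
qed

lemma F4_eq:
  "rt_F4 a b d f p = p $ 2 * F p * F1x p - 2 * Fx p * (weyl_amp p + p $ 2 * ricci_amp p)"
  by (simp add: rt_F4_def rt_F1_def F1x_def ricci_amp_def weyl_amp_def Let_def algebra_simps
      power2_eq_square power3_eq_cube)

lemma inheritance_equation:
  assumes "p \<in> M"
    and "rt_F1 f p - 2*a + 4*b*(p $ 2) \<noteq> 0"
    and "(p $ 2) * rt_F1 f p - 2*a*(p $ 2) + 6*d \<noteq> 0"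
  shows "lie_derivative (\<lambda>p. axis 3 1) (concircular g) i j s t p
    = rt_lambdaW a b d f p * concircular g i j s t p
      + rt_lambda1 a b d f p * kulkarni_nomizu g g i j s t p
      + rt_lambda2 a b d f p * kulkarni_nomizu g (ricci g) i j s t p"
proof -
  define r D E X y where "r = p $ 2" and "D = ricci_amp p" and "E = weyl_amp p"
    and "X = F1x p" and "y = Fx p / F p"
  define N where "N = r*X - 2*(E + r*D)*y"
  have nz: "r \<noteq> 0" "D \<noteq> 0" "E \<noteq> 0" "F p \<noteq> 0"
    using assms r_nz F_nz by (auto simp: r_def D_def E_def ricci_amp_def weyl_amp_def)
  have Fx: "Fx p = y * F p"
    using nz by (simp add: y_def)
  have F4: "rt_F4 a b d f p = F p * N"
    unfolding F4_eq r_def[symmetric] D_def[symmetric] E_def[symmetric] X_def[symmetric] Fx N_def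
    by (simp add: algebra_simps)
  \<comment> \<open>Every combination of \<open>a\<close>, \<open>d\<close> and \<open>F\<^sub>1\<close> in the coefficients is one of \<open>D\<close>, \<open>E\<close>, \<open>b\<close> and \<open>r\<close>.\<close>
  have amps: "6*d - 2*a*r + r*rt_F1 f p = E" "- 2*a + 12*b*r + rt_F1 f p = D + 8*b*r"
    "rt_F1 f p - 2*a + 12*b*r = D + 8*b*r" "- 6*d + 2*a*r - r*rt_F1 f p = - E"
    "2*a - 4*b*r - rt_F1 f p = - D" "- 2*a + 4*b*r + rt_F1 f p = D" "rt_F1 f p - 2*a + 4*b*r = D"
    "- 12*d + r*(D + 8*b*r) = 3*r*D - 2*E" "- 3*d + 2*b*r\<^sup>2 = - ((E - r*D)/2)"
    by (simp_all add: r_def D_def E_def ricci_amp_def weyl_amp_def field_simps power2_eq_square)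
  have X: "2*Fy p*Fxy p + Fx p*(Fxx p - Fyy p) - F p*(Fxyy p + Fxxx p) = X"
    by (simp add: X_def F1x_def algebra_simps)
  have "2*r*Fx p^3 + Fx p*(12*d - 4*a*r + 2*r*(Fy p)\<^sup>2 - r*F p*(3*Fxx p + Fyy p))
      + r*F p*(- 2*Fy p*Fxy p + F p*(Fxyy p + Fxxx p)) = 2*Fx p*E - r*F p*X"
    by (simp add: X_def F1x_def E_def r_def weyl_amp_def rt_F1_def Let_def algebra_simps
        power2_eq_square power3_eq_cube)
  then have third: "2*r*Fx p^3 + Fx p*(12*d - 4*a*r + 2*r*(Fy p)\<^sup>2 - r*F p*(3*Fxx p + Fyy p))
      + r*F p*(- 2*Fy p*Fxy p + F p*(Fxyy p + Fxxx p)) = F p*(2*y*E - r*X)"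
    by (simp add: Fx algebra_simps)
  have L: "rt_lambdaW a b d f p = N/E"
    unfolding rt_lambdaW_def Let_def r_def[symmetric] amps F4 using nz by simp
  have L1: "rt_lambda1 a b d f p
      = (8*b*r*E - (D + 8*b*r)*(3*r*D - 2*E))*N/(12*r^3*D*E)
        + (D + 8*b*r)*X/(12*r\<^sup>2*D) + 2*b*(2*y*E - r*X)/(3*r\<^sup>2*D)"
    unfolding rt_lambda1_def Let_def r_def[symmetric] X third amps F4 using nz
    by (simp add: divide_simps power2_eq_square power3_eq_cube)
  have L2: "rt_lambda2 a b d f p = y*E/(3*r*D) + (E - r*D)*N/(2*r*D*E)"
    unfolding rt_lambda2_def Let_def r_def[symmetric] amps F4 Fx using nz
    by (simp add: divide_simps)
  note coefficients = inheritance_algebra[where b = b and X = X and y = y, OF nz(1-3), folded N_def, folded L L1 L2]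
  show ?thesis
    unfolding lie_concircular_eq[OF assms(1)] concircular_eq[OF assms(1)] kulkarni_nomizu_metric
      kulkarni_nomizu_metric_ricci[OF assms(1)] r_def[symmetric] D_def[symmetric] E_def[symmetric]
      X_def[symmetric] y_def[symmetric] coefficients
    by (simp add: algebra_simps)
qed

lemma smooth_F1: "smooth_on M (rt_F1 f)"
  unfolding rt_F1_def[abs_def] Let_def
  by (intro smooth_on_add smooth_on_diff smooth_on_mult smooth_on_power smooth_xy smooth_partial
      smooth_f open_M)

lemma smooth_F4: "smooth_on M (rt_F4 a b d f)"
  unfolding rt_F4_def[abs_def] Let_def
  by (intro smooth_on_add smooth_on_diff smooth_on_mult smooth_on_power smooth_xy smooth_partial
      smooth_f open_M smooth_on_const smooth_on_nth)

lemma smooth_coefficients: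
  assumes D: "\<And>p. p \<in> M \<Longrightarrow> rt_F1 f p - 2*a + 4*b*(p $ 2) \<noteq> 0"
    and E: "\<And>p. p \<in> M \<Longrightarrow> (p $ 2) * rt_F1 f p - 2*a*(p $ 2) + 6*d \<noteq> 0"
  shows "smooth_on M (rt_lambdaW a b d f)" "smooth_on M (rt_lambda1 a b d f)"
    "smooth_on M (rt_lambda2 a b d f)"
proof -
  have nz: "- 6*d + 2*a*p $ 2 - p $ 2*rt_F1 f p \<noteq> 0" "2*a - 4*b*p $ 2 - rt_F1 f p \<noteq> 0"
    "- 2*a + 4*b*p $ 2 + rt_F1 f p \<noteq> 0" "rt_F1 f p - 2*a + 4*b*p $ 2 \<noteq> 0"
    "F p \<noteq> 0" "p $ 2 \<noteq> 0" if "p \<in> M" for p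
    using D[OF that] E[OF that] F_nz[OF that] r_nz[OF that] by auto
  note rules = smooth_on_add smooth_on_diff smooth_on_minus smooth_on_mult smooth_on_divide
    smooth_on_power smooth_xy smooth_partial smooth_f smooth_F1 smooth_F4 open_M
    smooth_on_const smooth_on_nth no_zero_divisors power_not_zero nz
  show "smooth_on M (rt_lambdaW a b d f)"
    unfolding rt_lambdaW_def[abs_def] Let_def by (intro rules)
  show "smooth_on M (rt_lambda1 a b d f)"
    unfolding rt_lambda1_def[abs_def] Let_def by (intro rules) simp_all
  show "smooth_on M (rt_lambda2 a b d f)"
    unfolding rt_lambda2_def[abs_def] Let_def by (intro rules) simp_all
qed

end

lemma open_rt_domain:
  assumes "open I" "open J" "open \<Omega>"
  shows "open (rt_domain I J \<Omega>)"
proof -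
  have "rt_domain I J \<Omega> = (\<lambda>p. p $ 1) -` I \<inter> (\<lambda>p. p $ 2) -` J \<inter> xy -` \<Omega>"
    by (auto simp: rt_domain_def)
  moreover have "continuous_on UNIV xy"
    by (rule linear_continuous_on[OF bounded_linear_xy])
  ultimately show ?thesis
    using assms by (auto intro!: open_Int open_vimage continuous_intros)
qed

theorem proposition4p4:
  fixes a b d :: real
    and I J :: "real set" and \<Omega> :: "(real^2) set"
    and f :: "real^2 \<Rightarrow> real"
  assumes "open I" and "is_interval I"
    and "open J" and "is_interval J" and "0 \<notin> J"
    and "open \<Omega>" and "connected \<Omega>" and "\<Omega> \<noteq> {}"
    and "smooth_on \<Omega> f" and "\<forall>u\<in>\<Omega>. f u \<noteq> 0"
    and "\<forall>p\<in>rt_domain I J \<Omega>. rt_F1 f p - 2*a + 4*b*(p $ 2) \<noteq> 0"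
    and "\<forall>p\<in>rt_domain I J \<Omega>. (p $ 2) * rt_F1 f p - 2*a*(p $ 2) + 6*d \<noteq> 0"
  shows "generalized_concircular_inheritance (rt_domain I J \<Omega>) (rt_metric a b d f) (\<lambda>p. axis 3 1)
           (rt_lambdaW a b d f) (rt_lambda1 a b d f) (rt_lambda2 a b d f)"
proof -
  interpret robinson_trautman a b d f \<Omega> "rt_domain I J \<Omega>"
    using assms open_rt_domain by unfold_locales (auto simp: rt_domain_def)
  show ?thesis
    unfolding generalized_concircular_inheritance_def
    using smooth_coefficients inheritance_equation assms(11,12) by blast
qed

end
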